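(* Let $DMU_o$, $o\in\{1,\dots,n\}$, be an inefficient DMU, let $(\lambda^*,S^{-*},S^{+*},d^*,b^*,U^*,V^* )$ be an optimal solution of problem (A) for $DMU_o$, let $P=(x_o^P,y_o^P)=(x_o-S^{-*},\,y_o+S^{+*})$ be the associated projection point, and let $E_o^P=\{j\in SE : d_j^*=0\}$. Let $R_{op}^{MC}$ be the maximal closest reference set of $DMU_o$ associated with $P$. Suppose that $(\mu^*,t^*,\bar U,\bar V,\eta^* )$ is an optimal solution of the linear program (B) built from $P$ and $E_o^P$. Then $$R_{op}^{MC}\subseteq\{DMU_j : j\in E_o^P,\ \mu_j^*>0\}.$$ (Problems (A), (B) and the set $R_{op}^{MC}$ are defined in the context.)
   Context: Data. There are $n$ decision making units (DMUs); $DMU_j$, $j=1,\dots,n$, has input vector $x_j=(x_{1j},\dots,x_{mj})$ and output vector $y_j=(y_{1j},\dots,y_{sj})$, both nonnegative and nonzero. Constant returns to scale are assumed: the production possibility set is $T=\{(x,y)\ge 0 : x\ge\sum_{j=1}^n\lambda_jx_j,\ y\le\sum_{j=1}^n\lambda_jy_j,\ \lambda_1,\dots,\lambda_n\ge0\}$. $DMU_j$ is (Pareto-)efficient if there is no $(x,y)\in T$ with $x\le x_j$, $y\ge y_j$ and $(x,y)\ne(x_j,y_j)$; otherwise it is inefficient. $SE\subseteq\{1,\dots,n\}$ is the set of indices of all efficient DMUs. $M$ is a fixed large positive constant. Problem (A) for $DMU_o$ (variables $\lambda,S^-=(s_i^-),S^+=(s_r^+),d,b,U=(u_r),V=(v_i)$):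 minimize $\sum_{i=1}^m s_i^-+\sum_{r=1}^s s_r^+$ subject to $\sum_{j\in SE}\lambda_jx_{ij}=x_{io}-s_i^-$ ($i=1,\dots,m$); $\sum_{j\in SE}\lambda_jy_{rj}=y_{ro}+s_r^+$ ($r=1,\dots,s$); $\sum_{i=1}^m v_ix_{ij}-\sum_{r=1}^s u_ry_{rj}-d_j=0$ ($j\in SE$); $d_j\le Mb_j$, $\lambda_j\le M(1-b_j)$, $\lambda_j,d_j\ge0$, $b_j\in\{0,1\}$ ($j\in SE$); $v_i\ge1$, $u_r\ge1$, $s_i^-\ge0$, $s_r^+\ge0$ (all $i,r$). Projection point. An optimal solution of (A) with slacks $S^{-*},S^{+*}$ has associated projection point $(x_o-S^{-*},y_o+S^{+*})$. Fix such a point $P=(x_o^P,y_o^P)$. Maximal closest reference set. The closest reference set given by an optimal solution of (A) with projection point $P$ is $\{DMU_j : j\in SE,\ \lambda_j^*>0\}$ for the $\lambda^*$ of that solution. The maximal closest reference set $R_{op}^{MC}$ is the union of the closest reference sets over all optimal solutions of (A) whose projection point is $P$; that is, $DMU_j\in R_{op}^{MC}$ iff $j\in SE$ and $\lambda_j>0$ in some optimal solution of (A) with projection point $P$. Linear program (B), built from $P$ and $E_o^P$ (variables $\mu_j,t_j$ for $j\in E_o^P$, $U=(u_r)$, $V=(v_i)$, $\eta$): maximize $\eta$ subject to $\sum_{j\in E_o^P}\mu_jx_{ij}=x_{io}^P$ ($i=1,\dots,m$); $\sum_{j\in E_o^P}\mu_jy_{rj}=y_{ro}^P$ ($r=1,\dots,s$);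 $\sum_{r=1}^su_ry_{ro}^P-\sum_{i=1}^mv_ix_{io}^P=0$; $\sum_{r=1}^su_ry_{rj}-\sum_{i=1}^mv_ix_{ij}+t_j=0$ ($j\in E_o^P$); $v_i\ge1$, $u_r\ge1$ (all $i,r$); $\mu_j+t_j\ge\eta$, $\mu_j\ge0$, $t_j\ge0$ ($j\in E_o^P$). *)

theory Defs
  imports "HOL-Analysis.Analysis"
begin

text \<open>
  The units are indexed by a finite type \<open>'n\<close>, inputs by \<open>'m\<close> and outputs by \<open>'s\<close>; unit \<open>j\<close> has
  input vector \<open>x j\<close> and output vector \<open>y j\<close>. The order on \<open>real ^ 'm\<close> and \<open>real ^ 's\<close> is the
  componentwise one.
\<close>

definition dea_data :: "('n::finite \<Rightarrow> real ^ 'm::finite) \<Rightarrow> ('n \<Rightarrow> real ^ 's::finite) \<Rightarrow> bool" where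
  "dea_data x y \<longleftrightarrow> (\<forall>j. 0 \<le> x j \<and> x j \<noteq> 0 \<and> 0 \<le> y j \<and> y j \<noteq> 0)"

definition production_set ::
  "('n::finite \<Rightarrow> real ^ 'm::finite) \<Rightarrow> ('n \<Rightarrow> real ^ 's::finite) \<Rightarrow> ((real ^ 'm) \<times> (real ^ 's)) set" where
  "production_set x y =
     {(p, q). 0 \<le> p \<and> 0 \<le> q \<and>
        (\<exists>lam :: 'n \<Rightarrow> real. (\<forall>j. 0 \<le> lam j) \<and>
           (\<Sum>j\<in>UNIV. lam j *\<^sub>R x j) \<le> p \<and> q \<le> (\<Sum>j\<in>UNIV. lam j *\<^sub>R y j))}"

definition efficient ::
  "('n::finite \<Rightarrow> real ^ 'm::finite) \<Rightarrow> ('n \<Rightarrow> real ^ 's::finite) \<Rightarrow> 'n \<Rightarrow> bool" where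
  "efficient x y j \<longleftrightarrow>
     \<not> (\<exists>p q. (p, q) \<in> production_set x y \<and> p \<le> x j \<and> y j \<le> q \<and> (p, q) \<noteq> (x j, y j))"

definition SE :: "('n::finite \<Rightarrow> real ^ 'm::finite) \<Rightarrow> ('n \<Rightarrow> real ^ 's::finite) \<Rightarrow> 'n set" where
  "SE x y = {j. efficient x y j}"

text \<open>
  In problem (A) the variables \<open>lam\<close>, \<open>d\<close>, \<open>b\<close> are meaningful on \<open>SE x y\<close> only, and in problem (B)
  the variables \<open>mu\<close>, \<open>t\<close> on \<open>E\<close> only; their values elsewhere are unconstrained and never used.
\<close>

definition feasible_A ::
  "real \<Rightarrow> ('n::finite \<Rightarrow> real ^ 'm::finite) \<Rightarrow> ('n \<Rightarrow> real ^ 's::finite) \<Rightarrow> 'n \<Rightarrow>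
   ('n \<Rightarrow> real) \<Rightarrow> real ^ 'm \<Rightarrow> real ^ 's \<Rightarrow> ('n \<Rightarrow> real) \<Rightarrow> ('n \<Rightarrow> real) \<Rightarrow>
   real ^ 's \<Rightarrow> real ^ 'm \<Rightarrow> bool" where
  "feasible_A M x y k lam Sm Sp d b U V \<longleftrightarrow>
     (\<forall>i. (\<Sum>j\<in>SE x y. lam j * x j $ i) = x k $ i - Sm $ i) \<and>
     (\<forall>r. (\<Sum>j\<in>SE x y. lam j * y j $ r) = y k $ r + Sp $ r) \<and>
     (\<forall>j\<in>SE x y. (\<Sum>i\<in>UNIV. V $ i * x j $ i) - (\<Sum>r\<in>UNIV. U $ r * y j $ r) - d j = 0) \<and>
     (\<forall>j\<in>SE x y. d j \<le> M * b j \<and> lam j \<le> M * (1 - b j) \<and>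
        0 \<le> lam j \<and> 0 \<le> d j \<and> b j \<in> {0, 1}) \<and>
     (\<forall>i. 1 \<le> V $ i) \<and> (\<forall>r. 1 \<le> U $ r) \<and> (\<forall>i. 0 \<le> Sm $ i) \<and> (\<forall>r. 0 \<le> Sp $ r)"

definition objective_A :: "real ^ 'm::finite \<Rightarrow> real ^ 's::finite \<Rightarrow> real" where
  "objective_A Sm Sp = (\<Sum>i\<in>UNIV. Sm $ i) + (\<Sum>r\<in>UNIV. Sp $ r)"

definition optimal_A ::
  "real \<Rightarrow> ('n::finite \<Rightarrow> real ^ 'm::finite) \<Rightarrow> ('n \<Rightarrow> real ^ 's::finite) \<Rightarrow> 'n \<Rightarrow>
   ('n \<Rightarrow> real) \<Rightarrow> real ^ 'm \<Rightarrow> real ^ 's \<Rightarrow> ('n \<Rightarrow> real) \<Rightarrow> ('n \<Rightarrow> real) \<Rightarrow>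
   real ^ 's \<Rightarrow> real ^ 'm \<Rightarrow> bool" where
  "optimal_A M x y k lam Sm Sp d b U V \<longleftrightarrow>
     feasible_A M x y k lam Sm Sp d b U V \<and>
     (\<forall>lam' Sm' Sp' d' b' U' V'. feasible_A M x y k lam' Sm' Sp' d' b' U' V' \<longrightarrow>
        objective_A Sm Sp \<le> objective_A Sm' Sp')"

definition projection_point ::
  "('n::finite \<Rightarrow> real ^ 'm::finite) \<Rightarrow> ('n \<Rightarrow> real ^ 's::finite) \<Rightarrow> 'n \<Rightarrow>
   real ^ 'm \<Rightarrow> real ^ 's \<Rightarrow> (real ^ 'm) \<times> (real ^ 's)" where
  "projection_point x y k Sm Sp = (x k - Sm, y k + Sp)"

definition closest_reference_set ::
  "('n::finite \<Rightarrow> real ^ 'm::finite) \<Rightarrow> ('n \<Rightarrow> real ^ 's::finite) \<Rightarrow> ('n \<Rightarrow> real) \<Rightarrow> 'n set" where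
  "closest_reference_set x y lam = {j \<in> SE x y. 0 < lam j}"

definition max_closest_reference_set ::
  "real \<Rightarrow> ('n::finite \<Rightarrow> real ^ 'm::finite) \<Rightarrow> ('n \<Rightarrow> real ^ 's::finite) \<Rightarrow> 'n \<Rightarrow>
   (real ^ 'm) \<times> (real ^ 's) \<Rightarrow> 'n set" where
  "max_closest_reference_set M x y k P =
     \<Union>{closest_reference_set x y lam | lam Sm Sp d b U V.
         optimal_A M x y k lam Sm Sp d b U V \<and> projection_point x y k Sm Sp = P}"

definition feasible_B ::
  "('n::finite \<Rightarrow> real ^ 'm::finite) \<Rightarrow> ('n \<Rightarrow> real ^ 's::finite) \<Rightarrow>
   (real ^ 'm) \<times> (real ^ 's) \<Rightarrow> 'n set \<Rightarrow>
   ('n \<Rightarrow> real) \<Rightarrow> ('n \<Rightarrow> real) \<Rightarrow> real ^ 's \<Rightarrow> real ^ 'm \<Rightarrow> real \<Rightarrow> bool" where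
  "feasible_B x y P E mu t U V eta \<longleftrightarrow>
     (\<forall>i. (\<Sum>j\<in>E. mu j * x j $ i) = fst P $ i) \<and>
     (\<forall>r. (\<Sum>j\<in>E. mu j * y j $ r) = snd P $ r) \<and>
     (\<Sum>r\<in>UNIV. U $ r * snd P $ r) - (\<Sum>i\<in>UNIV. V $ i * fst P $ i) = 0 \<and>
     (\<forall>j\<in>E. (\<Sum>r\<in>UNIV. U $ r * y j $ r) - (\<Sum>i\<in>UNIV. V $ i * x j $ i) + t j = 0) \<and>
     (\<forall>i. 1 \<le> V $ i) \<and> (\<forall>r. 1 \<le> U $ r) \<and>
     (\<forall>j\<in>E. eta \<le> mu j + t j \<and> 0 \<le> mu j \<and> 0 \<le> t j)"

definition optimal_B ::
  "('n::finite \<Rightarrow> real ^ 'm::finite) \<Rightarrow> ('n \<Rightarrow> real ^ 's::finite) \<Rightarrow>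
   (real ^ 'm) \<times> (real ^ 's) \<Rightarrow> 'n set \<Rightarrow>
   ('n \<Rightarrow> real) \<Rightarrow> ('n \<Rightarrow> real) \<Rightarrow> real ^ 's \<Rightarrow> real ^ 'm \<Rightarrow> real \<Rightarrow> bool" where
  "optimal_B x y P E mu t U V eta \<longleftrightarrow>
     feasible_B x y P E mu t U V eta \<and>
     (\<forall>mu' t' U' V' eta'. feasible_B x y P E mu' t' U' V' eta' \<longrightarrow> eta' \<le> eta)"

end

theory Submission
  imports Defs
begin

text \<open>
  Write \<open>P\<close> as a conic combination of the vectors \<open>(x\<^sub>j, -y\<^sub>j)\<close>, \<open>j \<in> E\<close>, and let \<open>(V, U)\<close> be the weights
  of the given solution of (A). By complementarity \<open>(V, U)\<close> annihilates \<open>P\<close>, so any optimal solution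
  of (A) projecting to \<open>P\<close> uses units of \<open>E\<close> only, and any feasible weights for (B) vanish on the
  units it uses (\<open>t\<^sub>j = 0\<close>). A Goldman--Tucker argument based on Farkas' lemma produces a strictly
  complementary pair; adding a large multiple of \<open>(V, U)\<close>, which vanishes on \<open>E\<close>, makes its weights at
  least \<open>1\<close>. So the optimal value of (B) is positive, hence \<open>t\<^sub>j = 0\<close> forces \<open>\<mu>\<^sub>j > 0\<close>.
\<close>

section \<open>Finitely generated cones and Farkas' lemma\<close>

text \<open>A finitely generated convex cone is polyhedral, hence closed, so a point outside it is
  strictly separated from it. Invariance under scaling then moves the separating level to 0.\<close>

lemma farkas:
  fixes z :: "'i \<Rightarrow> 'a::euclidean_space"
  assumes "finite I"
  shows "(\<exists>a. (\<forall>i\<in>I. 0 \<le> a i) \<and> (\<Sum>i\<in>I. a i *\<^sub>R z i) = p) \<or>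
         (\<exists>w. (\<forall>i\<in>I. 0 \<le> w \<bullet> z i) \<and> w \<bullet> p < 0)"
proof -
  define C where "C = convex_cone hull (z ` I)"
  \<comment> \<open>The explicit conic combinations. Minimality of the hull gives
    \<open>C \<subseteq> K\<close>, so membership in \<open>C\<close> yields coefficients.\<close>
  define K where "K = {\<Sum>i\<in>I. a i *\<^sub>R z i | a. \<forall>i\<in>I. 0 \<le> a i}"
  have "convex_cone K"
    unfolding convex_cone_iff
  proof (intro conjI ballI allI impI)
    show "0 \<in> K"
      unfolding K_def by (rule CollectI, rule exI[of _ "\<lambda>_. 0"]) simp
  next
    fix u v assume "u \<in> K" "v \<in> K"
    then obtain a b where "\<forall>i\<in>I. 0 \<le> a i" "u = (\<Sum>i\<in>I. a i *\<^sub>R z i)"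
      "\<forall>i\<in>I. 0 \<le> b i" "v = (\<Sum>i\<in>I. b i *\<^sub>R z i)"
      unfolding K_def by blast
    then show "u + v \<in> K"
      unfolding K_def
      by (intro CollectI exI[of _ "\<lambda>i. a i + b i"]) (auto simp: scaleR_add_left sum.distrib)
  next
    fix u and c :: real assume "u \<in> K" "0 \<le> c"
    then obtain a where "\<forall>i\<in>I. 0 \<le> a i" "u = (\<Sum>i\<in>I. a i *\<^sub>R z i)"
      unfolding K_def by blast
    with \<open>0 \<le> c\<close> show "c *\<^sub>R u \<in> K"
      unfolding K_def
      by (intro CollectI exI[of _ "\<lambda>i. c * a i"]) (auto simp: scaleR_sum_right)
  qed
  moreover have "z ` I \<subseteq> K"
  proof (rule image_subsetI)
    fix j assume "j \<in> I"
    have "(\<Sum>i\<in>I. (if i = j then 1 else 0) *\<^sub>R z i) = (\<Sum>i\<in>I. if i = j then z i else 0)"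
      by (rule sum.cong) auto
    then have "(\<Sum>i\<in>I. (if i = j then 1 else 0) *\<^sub>R z i) = z j"
      using \<open>j \<in> I\<close> assms by simp
    then show "z j \<in> K"
      unfolding K_def by (intro CollectI exI[of _ "\<lambda>i. if i = j then 1 else 0"]) auto
  qed
  ultimately have "C \<subseteq> K"
    unfolding C_def by (rule hull_minimal[rotated])
  show ?thesis
  proof (cases "p \<in> C")
    case True
    with \<open>C \<subseteq> K\<close> show ?thesis unfolding K_def by blast
  next
    case False
    have "closed C"
      unfolding C_def using assms by (simp add: polyhedron_convex_cone_hull polyhedron_imp_closed)
    with False obtain w b where wb: "w \<bullet> p < b" "\<And>c. c \<in> C \<Longrightarrow> b < w \<bullet> c"
      using separating_hyperplane_closed_point[of C p]
      by (auto simp: C_def convex_convex_cone_hull)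
    have "b < 0"
      using wb(2)[of 0] by (simp add: C_def convex_cone_hull_contains_0)
    have "0 \<le> w \<bullet> z i" if "i \<in> I" for i
    proof (rule ccontr)
      assume neg: "\<not> 0 \<le> w \<bullet> z i"
      \<comment> \<open>This multiple of \<open>z i\<close> has inner product exactly
        \<open>b\<close> with \<open>w\<close>, against the strict bound on \<open>C\<close>. The
        factor is positive because \<open>b\<close> and \<open>w \<bullet> z i\<close> are both
        negative.\<close>
      have "(b / (w \<bullet> z i)) *\<^sub>R z i \<in> C"
        unfolding C_def using that neg \<open>b < 0\<close>
        by (intro convex_cone_hull_mul hull_inc) (auto simp: divide_nonpos_neg)
      from wb(2)[OF this] neg show False by simp
    qed
    with wb(1) \<open>b < 0\<close> show ?thesis by (intro disjI2 exI[of _ w]) auto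
  qed
qed

section \<open>Strict complementarity in the sense of Goldman and Tucker\<close>

text \<open>The alternative at a single index: either \<open>- z j\<close> lies in the cone spanned
  by the \<open>z i\<close> and \<open>- p\<close>, so that \<open>z j\<close> can take part in a
  representation of \<open>p\<close>, or a functional separates it from that cone.\<close>

lemma positive_coefficient_or_positive_functional:
  fixes z :: "'i \<Rightarrow> 'a::euclidean_space"
  assumes "finite I" "j \<in> I" "\<forall>i\<in>I. 0 \<le> lam i" "(\<Sum>i\<in>I. lam i *\<^sub>R z i) = p"
  shows "(\<exists>mu. (\<forall>i\<in>I. 0 \<le> mu i) \<and> (\<Sum>i\<in>I. mu i *\<^sub>R z i) = p \<and> 0 < mu j) \<or>
         (\<exists>w. (\<forall>i\<in>I. 0 \<le> w \<bullet> z i) \<and> w \<bullet> p = 0 \<and> 0 < w \<bullet> z j)"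
proof -
  text \<open>Farkas' lemma for \<open>-z j\<close> and the vectors \<open>z i\<close> together with \<open>-p\<close>, the latter indexed by \<open>None\<close>.\<close>
  let ?z = "case_option (- p) z" and ?I = "insert None (Some ` I)"
  have "(\<exists>a. (\<forall>i\<in>?I. 0 \<le> a i) \<and> (\<Sum>i\<in>?I. a i *\<^sub>R ?z i) = - z j) \<or>
        (\<exists>w. (\<forall>i\<in>?I. 0 \<le> w \<bullet> ?z i) \<and> w \<bullet> (- z j) < 0)"
    using assms(1) by (intro farkas) simp
  then consider
    (combination) a c where "\<forall>i\<in>I. 0 \<le> a i" "0 \<le> c" "(\<Sum>i\<in>I. a i *\<^sub>R z i) - c *\<^sub>R p = - z j"
    | (functional) w where "\<forall>i\<in>I. 0 \<le> w \<bullet> z i" "w \<bullet> p \<le> 0" "0 < w \<bullet> z j"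
  proof (elim disjE exE conjE)
    fix a assume a: "\<forall>i\<in>?I. 0 \<le> a i" "(\<Sum>i\<in>?I. a i *\<^sub>R ?z i) = - z j"
    have "(\<Sum>i\<in>?I. a i *\<^sub>R ?z i) = (\<Sum>i\<in>I. a (Some i) *\<^sub>R z i) - a None *\<^sub>R p"
      using assms(1) by (subst sum.insert) (auto simp: sum.reindex)
    with a show thesis by (intro combination[of "\<lambda>i. a (Some i)" "a None"]) auto
  next
    fix w assume "\<forall>i\<in>?I. 0 \<le> w \<bullet> ?z i" "w \<bullet> (- z j) < 0"
    then show thesis by (intro functional[of w]) auto
  qed
  then show ?thesis
  proof cases
    case combination
    \<comment> \<open>The three summands represent \<open>p\<close>,
      \<open>c *\<^sub>R p - z j\<close> and \<open>z j\<close>, which add up to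
      \<open>(1 + c) *\<^sub>R p\<close>. The last one makes the coefficient at \<open>j\<close>
      positive.\<close>
    define mu where "mu i = (lam i + a i + (if i = j then 1 else 0)) / (1 + c)" for i
    have "(\<Sum>i\<in>I. (if i = j then 1 else 0) *\<^sub>R z i) = (\<Sum>i\<in>I. if i = j then z i else 0)"
      by (rule sum.cong) auto
    then have "(\<Sum>i\<in>I. (if i = j then 1 else 0) *\<^sub>R z i) = z j"
      using assms(1,2) by simp
    moreover have "(\<Sum>i\<in>I. mu i *\<^sub>R z i) = (1 / (1 + c)) *\<^sub>R
        ((\<Sum>i\<in>I. lam i *\<^sub>R z i) + (\<Sum>i\<in>I. a i *\<^sub>R z i) + (\<Sum>i\<in>I. (if i = j then 1 else 0) *\<^sub>R z i))"
      unfolding sum.distrib[symmetric] scaleR_sum_right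
      by (rule sum.cong) (simp_all add: mu_def scaleR_add_left[symmetric])
    moreover have "(\<Sum>i\<in>I. a i *\<^sub>R z i) = c *\<^sub>R p - z j"
      using combination(3) by (simp add: algebra_simps)
    ultimately have "(\<Sum>i\<in>I. mu i *\<^sub>R z i) = (1 / (1 + c)) *\<^sub>R ((1 + c) *\<^sub>R p)"
      using assms(4) by (simp add: scaleR_add_left)
    then have "(\<Sum>i\<in>I. mu i *\<^sub>R z i) = p"
      using combination(2) by simp
    moreover have "\<forall>i\<in>I. 0 \<le> mu i"
      using assms(3) combination by (simp add: mu_def)
    moreover have "0 < mu j"
      using assms(2,3) combination by (simp add: mu_def add_nonneg_pos)
    ultimately show ?thesis by blast
  next
    case functional
    \<comment> \<open>Farkas gives only \<open>w \<bullet> p \<le> 0\<close>; the reverse inequality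
      holds because \<open>p\<close> is itself a conic combination.\<close>
    have "w \<bullet> p = (\<Sum>i\<in>I. lam i * (w \<bullet> z i))"
      unfolding assms(4)[symmetric] by (simp add: inner_sum_right)
    also have "\<dots> \<ge> 0"
      using assms(3) functional by (simp add: sum_nonneg)
    finally show ?thesis using functional by (intro disjI2 exI[of _ w]) auto
  qed
qed

text \<open>Choose a pair for each index, then average the coefficients and sum the functionals. All
  terms being nonnegative, positivity gained at one index survives.\<close>

lemma strictly_complementary_pair:
  fixes z :: "'i \<Rightarrow> 'a::euclidean_space"
  assumes "finite I" "\<forall>i\<in>I. 0 \<le> lam i" "(\<Sum>i\<in>I. lam i *\<^sub>R z i) = p"
  obtains mu w where "\<forall>i\<in>I. 0 \<le> mu i" "(\<Sum>i\<in>I. mu i *\<^sub>R z i) = p"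
    "\<forall>i\<in>I. 0 \<le> w \<bullet> z i" "w \<bullet> p = 0" "\<forall>i\<in>I. 0 < mu i + w \<bullet> z i"
\<comment> \<open>The average divides by \<open>card I\<close>, so the empty index set is
  separate.\<close>
proof (cases "I = {}")
  case True
  then show thesis using that[of lam 0] assms by simp
next
  case False
  have ex: "\<exists>mu w. (\<forall>i\<in>I. 0 \<le> mu i) \<and> (\<Sum>i\<in>I. mu i *\<^sub>R z i) = p \<and>
      (\<forall>i\<in>I. 0 \<le> w \<bullet> z i) \<and> w \<bullet> p = 0 \<and> (0 < mu j \<or> 0 < w \<bullet> z j)" if "j \<in> I" for j
    using positive_coefficient_or_positive_functional[OF assms(1) that assms(2,3)]
  proof (elim disjE exE conjE)
    fix mu assume "\<forall>i\<in>I. 0 \<le> mu i" "(\<Sum>i\<in>I. mu i *\<^sub>R z i) = p" "0 < mu j"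
    then show ?thesis by (intro exI[of _ mu] exI[of _ 0]) simp
  next
    fix w assume "\<forall>i\<in>I. 0 \<le> w \<bullet> z i" "w \<bullet> p = 0" "0 < w \<bullet> z j"
    then show ?thesis using assms(2,3) by (intro exI[of _ lam] exI[of _ w]) simp
  qed
  have "\<exists>m. \<forall>j\<in>I. \<exists>w. (\<forall>i\<in>I. 0 \<le> m j i) \<and> (\<Sum>i\<in>I. m j i *\<^sub>R z i) = p \<and>
      (\<forall>i\<in>I. 0 \<le> w \<bullet> z i) \<and> w \<bullet> p = 0 \<and> (0 < m j j \<or> 0 < w \<bullet> z j)"
    by (rule bchoice) (use ex in blast)
  then obtain m where "\<forall>j\<in>I. \<exists>w. (\<forall>i\<in>I. 0 \<le> m j i) \<and> (\<Sum>i\<in>I. m j i *\<^sub>R z i) = p \<and>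
      (\<forall>i\<in>I. 0 \<le> w \<bullet> z i) \<and> w \<bullet> p = 0 \<and> (0 < m j j \<or> 0 < w \<bullet> z j)" ..
  from bchoice[OF this] obtain w where
    "\<forall>j\<in>I. (\<forall>i\<in>I. 0 \<le> m j i) \<and> (\<Sum>i\<in>I. m j i *\<^sub>R z i) = p \<and>
      (\<forall>i\<in>I. 0 \<le> w j \<bullet> z i) \<and> w j \<bullet> p = 0 \<and> (0 < m j j \<or> 0 < w j \<bullet> z j)" ..
  then have mw: "\<And>j i. j \<in> I \<Longrightarrow> i \<in> I \<Longrightarrow> 0 \<le> m j i"
    "\<And>j. j \<in> I \<Longrightarrow> (\<Sum>i\<in>I. m j i *\<^sub>R z i) = p"
    "\<And>j i. j \<in> I \<Longrightarrow> i \<in> I \<Longrightarrow> 0 \<le> w j \<bullet> z i"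
    "\<And>j. j \<in> I \<Longrightarrow> w j \<bullet> p = 0"
    "\<And>j. j \<in> I \<Longrightarrow> 0 < m j j \<or> 0 < w j \<bullet> z j"
    by blast+
  define N where "N = real (card I)"
  have "0 < N" using False assms(1) by (simp add: N_def card_gt_0_iff)
  define mu where "mu i = (\<Sum>j\<in>I. m j i) / N" for i
  define W where "W = (\<Sum>j\<in>I. w j)"
  have W: "W \<bullet> v = (\<Sum>j\<in>I. w j \<bullet> v)" for v
    by (simp add: W_def inner_sum_left)
  show thesis
  proof (rule that)
    show mu0: "\<forall>i\<in>I. 0 \<le> mu i"
      using mw(1) \<open>0 < N\<close> by (simp add: mu_def sum_nonneg)
    have "(\<Sum>i\<in>I. mu i *\<^sub>R z i) = (1 / N) *\<^sub>R (\<Sum>i\<in>I. \<Sum>j\<in>I. m j i *\<^sub>R z i)"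
      by (simp add: mu_def scaleR_sum_right scaleR_sum_left sum_divide_distrib)
    also have "(\<Sum>i\<in>I. \<Sum>j\<in>I. m j i *\<^sub>R z i) = (\<Sum>j\<in>I. p)"
      by (subst sum.swap) (simp add: mw(2))
    also have "\<dots> = N *\<^sub>R p"
      unfolding N_def by (rule sum_constant_scaleR)
    finally show "(\<Sum>i\<in>I. mu i *\<^sub>R z i) = p"
      using \<open>0 < N\<close> by simp
    show W0: "\<forall>i\<in>I. 0 \<le> W \<bullet> z i"
      using mw(3) by (simp add: W sum_nonneg)
    show "W \<bullet> p = 0"
      using mw(4) by (simp add: W)
    show "\<forall>i\<in>I. 0 < mu i + W \<bullet> z i"
    proof
      fix i assume "i \<in> I"
      from mw(5)[OF this] show "0 < mu i + W \<bullet> z i"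
      proof
        assume "0 < m i i"
        then have "0 < mu i"
          unfolding mu_def using \<open>i \<in> I\<close> mw(1) assms(1) \<open>0 < N\<close>
          by (intro divide_pos_pos sum_pos2[of I i]) auto
        with W0 \<open>i \<in> I\<close> show ?thesis by (simp add: add_pos_nonneg)
      next
        assume "0 < w i \<bullet> z i"
        then have "0 < W \<bullet> z i"
          unfolding W using \<open>i \<in> I\<close> mw(3) assms(1) by (intro sum_pos2[of I i]) auto
        with mu0 \<open>i \<in> I\<close> show ?thesis by (simp add: add_nonneg_pos)
      qed
    qed
  qed
qed

section \<open>Problems (A) and (B) in vector form, and complementarity\<close>

lemma feasible_A_iff_vector:
  "feasible_A M x y k lam Sm Sp d b U V \<longleftrightarrow>
     (\<Sum>j\<in>SE x y. lam j *\<^sub>R x j) = x k - Sm \<and>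
     (\<Sum>j\<in>SE x y. lam j *\<^sub>R y j) = y k + Sp \<and>
     (\<forall>j\<in>SE x y. V \<bullet> x j - U \<bullet> y j = d j) \<and>
     (\<forall>j\<in>SE x y. d j \<le> M * b j \<and> lam j \<le> M * (1 - b j) \<and>
        0 \<le> lam j \<and> 0 \<le> d j \<and> b j \<in> {0, 1}) \<and>
     (\<forall>i. 1 \<le> V $ i) \<and> (\<forall>r. 1 \<le> U $ r) \<and> (\<forall>i. 0 \<le> Sm $ i) \<and> (\<forall>r. 0 \<le> Sp $ r)"
  unfolding feasible_A_def by (simp add: vec_eq_iff inner_vec_def)

lemma feasible_B_iff_vector:
  "feasible_B x y P E mu t U V eta \<longleftrightarrow>
     (\<Sum>j\<in>E. mu j *\<^sub>R x j) = fst P \<and>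
     (\<Sum>j\<in>E. mu j *\<^sub>R y j) = snd P \<and>
     V \<bullet> fst P = U \<bullet> snd P \<and>
     (\<forall>j\<in>E. t j = V \<bullet> x j - U \<bullet> y j) \<and>
     (\<forall>i. 1 \<le> V $ i) \<and> (\<forall>r. 1 \<le> U $ r) \<and>
     (\<forall>j\<in>E. eta \<le> mu j + t j \<and> 0 \<le> mu j \<and> 0 \<le> t j)"
  unfolding feasible_B_def by (auto simp: vec_eq_iff inner_vec_def algebra_simps)

text \<open>The binary \<open>b j\<close> closes one side: 0 forces \<open>d j = 0\<close>, and 1
  forces \<open>lam j = 0\<close>.\<close>

lemma feasible_A_complementary:
  assumes "feasible_A M x y k lam Sm Sp d b U V" "j \<in> SE x y"
  shows "lam j * d j = 0"
proof -
  have "b j = 0 \<or> b j = 1" "d j \<le> M * b j" "lam j \<le> M * (1 - b j)" "0 \<le> lam j" "0 \<le> d j"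
    using assms unfolding feasible_A_def by auto
  then show ?thesis by (elim disjE) auto
qed

text \<open>The nonnegative terms \<open>lam j * (V \<bullet> x j - U \<bullet> y j)\<close> sum to
  0, so each vanishes. This serves both for the weights of (A) and for those of (B).\<close>

lemma combination_functional_eq_0D:
  fixes x :: "'n \<Rightarrow> 'a::real_inner" and y :: "'n \<Rightarrow> 'b::real_inner"
  assumes "finite I" "(\<Sum>j\<in>I. lam j *\<^sub>R x j) = p" "(\<Sum>j\<in>I. lam j *\<^sub>R y j) = q"
    and "V \<bullet> p = U \<bullet> q"
    and "\<And>j. j \<in> I \<Longrightarrow> 0 \<le> lam j" "\<And>j. j \<in> I \<Longrightarrow> 0 \<le> V \<bullet> x j - U \<bullet> y j"
    and "j \<in> I" "0 < lam j"
  shows "V \<bullet> x j - U \<bullet> y j = 0"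
proof -
  have "(\<Sum>j\<in>I. lam j * (V \<bullet> x j - U \<bullet> y j)) = V \<bullet> p - U \<bullet> q"
    unfolding assms(2,3)[symmetric]
    by (simp add: inner_sum_right sum_subtractf right_diff_distrib)
  then have "(\<Sum>j\<in>I. lam j * (V \<bullet> x j - U \<bullet> y j)) = 0"
    using assms(4) by simp
  then have "lam j * (V \<bullet> x j - U \<bullet> y j) = 0"
    using assms by (subst (asm) sum_nonneg_eq_0_iff) auto
  with assms(8) show ?thesis by simp
qed

section \<open>Positive optimal value of (B)\<close>

lemma positive_value_B:
  fixes x :: "'n::finite \<Rightarrow> real ^ 'm::finite" and y :: "'n \<Rightarrow> real ^ 's::finite"
  assumes lam: "\<forall>j\<in>E. 0 \<le> lam j" "(\<Sum>j\<in>E. lam j *\<^sub>R x j) = fst P" "(\<Sum>j\<in>E. lam j *\<^sub>R y j) = snd P"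
    and UV: "\<forall>i. 1 \<le> V $ i" "\<forall>r. 1 \<le> U $ r" "\<forall>j\<in>E. V \<bullet> x j = U \<bullet> y j" "V \<bullet> fst P = U \<bullet> snd P"
  obtains mu t U' V' eta where "feasible_B x y P E mu t U' V' eta" "0 < eta"
proof -
  let ?z = "\<lambda>j. (x j, - y j)"
  have sum_z: "(\<Sum>j\<in>E. a j *\<^sub>R ?z j) = (\<Sum>j\<in>E. a j *\<^sub>R x j, - (\<Sum>j\<in>E. a j *\<^sub>R y j))" for a
    by (auto simp: prod_eq_iff fst_sum snd_sum sum_negf)
  have "(\<Sum>j\<in>E. lam j *\<^sub>R ?z j) = (fst P, - snd P)"
    unfolding sum_z lam(2,3) ..
  then obtain mu w where mu: "\<forall>i\<in>E. 0 \<le> mu i" "(\<Sum>i\<in>E. mu i *\<^sub>R ?z i) = (fst P, - snd P)"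
    and w: "\<forall>i\<in>E. 0 \<le> w \<bullet> ?z i" "w \<bullet> (fst P, - snd P) = 0"
    and pos: "\<forall>i\<in>E. 0 < mu i + w \<bullet> ?z i"
    by (rule strictly_complementary_pair[OF finite lam(1)])
  \<comment> \<open>Components of \<open>w\<close> are at least minus the norm of their block, and
    those of \<open>V\<close> and \<open>U\<close> are at least 1, so the shifted weights stay at
    least 1.\<close>
  define K where "K = 1 + norm (fst w) + norm (snd w)"
  define V' where "V' = K *\<^sub>R V + fst w"
  define U' where "U' = K *\<^sub>R U + snd w"
  have "1 \<le> K" by (simp add: K_def)
  have V': "1 \<le> V' $ i" for i
  proof -
    have "K * 1 \<le> K * V $ i"
      using UV(1) \<open>1 \<le> K\<close> by (intro mult_left_mono) auto
    moreover have "\<bar>fst w $ i\<bar> \<le> norm (fst w)" by (rule component_le_norm_cart)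
    moreover have "0 \<le> norm (snd w)" by simp
    moreover have "V' $ i = K * V $ i + fst w $ i" by (simp add: V'_def)
    ultimately show ?thesis using K_def by linarith
  qed
  have U': "1 \<le> U' $ r" for r
  proof -
    have "K * 1 \<le> K * U $ r"
      using UV(2) \<open>1 \<le> K\<close> by (intro mult_left_mono) auto
    moreover have "\<bar>snd w $ r\<bar> \<le> norm (snd w)" by (rule component_le_norm_cart)
    moreover have "0 \<le> norm (fst w)" by simp
    moreover have "U' $ r = K * U $ r + snd w $ r" by (simp add: U'_def)
    ultimately show ?thesis using K_def by linarith
  qed
  have shift: "V' \<bullet> p - U' \<bullet> q = w \<bullet> (p, - q)" if "V \<bullet> p = U \<bullet> q" for p q
    using that by (simp add: V'_def U'_def inner_prod_def inner_add_left)
  \<comment> \<open>The inserted 1 keeps the minimum meaningful and positive when \<open>E\<close>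
    is empty.\<close>
  define eta where "eta = Min (insert 1 ((\<lambda>i. mu i + w \<bullet> ?z i) ` E))"
  have "0 < eta" using pos by (simp add: eta_def)
  have "eta \<le> mu j + w \<bullet> ?z j" if "j \<in> E" for j
    unfolding eta_def using that by (intro Min_le) auto
  moreover have "(\<Sum>i\<in>E. mu i *\<^sub>R x i) = fst P" "(\<Sum>i\<in>E. mu i *\<^sub>R y i) = snd P"
    using mu(2) unfolding sum_z by simp_all
  moreover have "V' \<bullet> fst P = U' \<bullet> snd P"
    using shift[OF UV(4)] w(2) by simp
  moreover have "\<forall>j\<in>E. w \<bullet> ?z j = V' \<bullet> x j - U' \<bullet> y j"
    using shift UV(3) by metis
  ultimately have "feasible_B x y P E mu (\<lambda>j. w \<bullet> ?z j) U' V' eta"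
    unfolding feasible_B_iff_vector using mu(1) w(1) V' U' by blast
  with \<open>0 < eta\<close> show thesis using that by blast
qed

section \<open>Support of the closest reference sets and the inclusion\<close>

theorem theorem1:
  fixes x :: "'n::finite \<Rightarrow> real ^ 'm::finite"
    and y :: "'n \<Rightarrow> real ^ 's::finite"
    and M :: real
    and k :: 'n
    and lam d b :: "'n \<Rightarrow> real"
    and Sm :: "real ^ 'm" and Sp :: "real ^ 's"
    and U :: "real ^ 's" and V :: "real ^ 'm"
    and P :: "(real ^ 'm) \<times> (real ^ 's)"
    and E :: "'n set"
    and mu t :: "'n \<Rightarrow> real"
    and Ubar :: "real ^ 's" and Vbar :: "real ^ 'm"
    and eta :: real
  assumes "dea_data x y"
    and "0 < M"
    and "\<not> efficient x y k"
    and "optimal_A M x y k lam Sm Sp d b U V"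
    and "P = projection_point x y k Sm Sp"
    and "E = {j \<in> SE x y. d j = 0}"
    and "optimal_B x y P E mu t Ubar Vbar eta"
  shows "max_closest_reference_set M x y k P \<subseteq> {j \<in> E. 0 < mu j}"
proof
  fix j assume "j \<in> max_closest_reference_set M x y k P"
  then obtain lam' Sm' Sp' d' b' U' V'
    where A': "feasible_A M x y k lam' Sm' Sp' d' b' U' V'"
      and P': "projection_point x y k Sm' Sp' = P"
      and j: "j \<in> SE x y" "0 < lam' j"
    unfolding max_closest_reference_set_def optimal_A_def closest_reference_set_def by blast
  have A: "feasible_A M x y k lam Sm Sp d b U V"
    using assms(4) by (simp add: optimal_A_def)
  have B: "feasible_B x y P E mu t Ubar Vbar eta"
    using assms(7) by (simp add: optimal_B_def)
  have sums: "(\<Sum>j\<in>SE x y. lam j *\<^sub>R x j) = fst P" "(\<Sum>j\<in>SE x y. lam j *\<^sub>R y j) = snd P"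
    using A assms(5) by (simp_all add: feasible_A_iff_vector projection_point_def)
  have sums': "(\<Sum>j\<in>SE x y. lam' j *\<^sub>R x j) = fst P" "(\<Sum>j\<in>SE x y. lam' j *\<^sub>R y j) = snd P"
    using A' P' by (auto simp: feasible_A_iff_vector projection_point_def)
  have d: "\<And>i. i \<in> SE x y \<Longrightarrow> V \<bullet> x i - U \<bullet> y i = d i" "\<And>i. i \<in> SE x y \<Longrightarrow> 0 \<le> d i"
    and lam'_nonneg: "\<And>i. i \<in> SE x y \<Longrightarrow> 0 \<le> lam' i"
    using A A' by (auto simp: feasible_A_iff_vector)
  have "V \<bullet> fst P - U \<bullet> snd P = (\<Sum>i\<in>SE x y. lam i * (V \<bullet> x i - U \<bullet> y i))"
    unfolding sums[symmetric] by (simp add: inner_sum_right sum_subtractf right_diff_distrib)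
  also have "\<dots> = (\<Sum>i\<in>SE x y. lam i * d i)"
    by (simp add: d)
  also have "\<dots> = 0"
    by (rule sum.neutral) (use feasible_A_complementary[OF A] in blast)
  finally have VU: "V \<bullet> fst P = U \<bullet> snd P" by simp
  \<comment> \<open>The weights \<open>V\<close>, \<open>U\<close> of the given solution are tested
    against the coefficients \<open>lam'\<close> of the other one; this works because both project
    to \<open>P\<close>.\<close>
  have support: "i \<in> E" if "i \<in> SE x y" "0 < lam' i" for i
    using combination_functional_eq_0D[OF _ sums' VU, of i] that d lam'_nonneg assms(6) by simp
  have "j \<in> E" using support j by blast
  have zero: "lam' i = 0" if "i \<in> SE x y - E" for i
    using support[of i] lam'_nonneg[of i] that by fastforce
  have restrict: "(\<Sum>i\<in>E. lam' i *\<^sub>R x i) = fst P" "(\<Sum>i\<in>E. lam' i *\<^sub>R y i) = snd P"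
    using sums' zero sum.mono_neutral_left[of "SE x y" E "\<lambda>i. lam' i *\<^sub>R x i"]
      sum.mono_neutral_left[of "SE x y" E "\<lambda>i. lam' i *\<^sub>R y i"] assms(6) by auto
  \<comment> \<open>\<open>lam'\<close> represents \<open>P\<close> over \<open>E\<close> alone, and
    the weights of (B) annihilate \<open>P\<close>, so \<open>t\<close> vanishes wherever
    \<open>lam'\<close> is positive.\<close>
  have "t j = 0"
  proof -
    have "Vbar \<bullet> x j - Ubar \<bullet> y j = 0"
      by (rule combination_functional_eq_0D[OF _ restrict])
        (use B lam'_nonneg \<open>j \<in> E\<close> j assms(6) in \<open>auto simp: feasible_B_iff_vector\<close>)
    with B \<open>j \<in> E\<close> show ?thesis by (simp add: feasible_B_iff_vector)
  qed
  have nonneg: "\<forall>i\<in>E. 0 \<le> lam' i" and weights: "\<forall>i. 1 \<le> V $ i" "\<forall>r. 1 \<le> U $ r" "\<forall>i\<in>E. V \<bullet> x i = U \<bullet> y i"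
    using A lam'_nonneg assms(6) by (auto simp: feasible_A_iff_vector)
  obtain mu' t' U'' V'' eta' where "feasible_B x y P E mu' t' U'' V'' eta'" "0 < eta'"
    by (rule positive_value_B[OF nonneg restrict weights VU])
  then have "0 < eta"
    using assms(7) unfolding optimal_B_def by (meson less_le_trans)
  moreover have "eta \<le> mu j + t j"
    using B \<open>j \<in> E\<close> by (simp add: feasible_B_def)
  ultimately show "j \<in> {j \<in> E. 0 < mu j}"
    using \<open>t j = 0\<close> \<open>j \<in> E\<close> by simp
qed

end
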